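(* Let $C$ and $L$ be distributive lattices such that $C$ is a sublattice of $L$. For $Y\in L$, denote by $C_Y\subset L$ the distributive lattice $\{U\wedge Y\mid U\in C\}$. Then $\overline{Q(C,\mathfrak{P}_Y)}$ is canonically isomorphic to $C_Y$ as categories.
   Context: A lattice is regarded as a category with a unique morphism $U\to V$ if $U\le V$ and none otherwise. Path structure on $C$. Let $\Gamma$ be the set of functions $\gamma:[0,1]\to C$ obtained as follows: for some $n\ge1$, a partition of $[0,1]$ into subintervals $I_0,\dots,I_n$ listed in increasing order, and elements $U_0\le U_1\le\cdots\le U_n$ of $C$, put $\gamma(t)=U_i$ for $t\in I_i$. Put $\gamma\sim\gamma'$ iff $\gamma(0)=\gamma'(0)$ and $\gamma(1)=\gamma'(1)$; $[\gamma]$ is the class of $\gamma$. The category $C$ is then the category with objects the elements of $C$, morphisms $U\to V$ the classes $[\gamma]$ with $\gamma(0)=U$, $\gamma(1)=V$, and composition by concatenation. The partition $\mathfrak{P}_Y$. For $Y\in L$ and $Z\le Y$ in $L$ let $A_Z=\{U\in C\mid U\wedge Y=Z\}$. $\mathfrak{P}_Y$ is the partition of $C$ into the nonempty $A_Z$; its elements are called pixels. Pixelation. $\Sigma_{\mathfrak{P}_Y}$ is the class of morphisms $[\rho]$ of $C$ with $\mathrm{im}(\rho)$ contained in one pixel; it admits a two-sided calculus of fractions, giving $C[\Sigma_{\mathfrak{P}_Y}^{-1}]$. Choose an element $s_{\mathsf{X}}$ in each pixel $\mathsf{X}$. A pseudo arrow is a morphism $[\rho]^{-1}[\gamma]$ of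 $C[\Sigma_{\mathfrak{P}_Y}^{-1}]$ with $[\rho]\in\Sigma_{\mathfrak{P}_Y}$ such that $[0,1]$ can be partitioned into exactly two subintervals which $\gamma$ maps into two distinct pixels respectively. $Q(C,\mathfrak{P}_Y)$ is the quiver with vertices the pixels and arrows $\mathsf{X}\to\mathsf{X}'$ the pseudo arrows $s_{\mathsf{X}}\to s_{\mathsf{X}'}$ (at most one). Let $\Psi$ be the functor from the free category on this quiver to $C[\Sigma_{\mathfrak{P}_Y}^{-1}]$, $\mathsf{X}\mapsto s_{\mathsf{X}}$, sending each arrow to its pseudo arrow; $\overline{Q(C,\mathfrak{P}_Y)}$ is the quotient of the free category identifying parallel morphisms $f,g$ with $\Psi(f)=\Psi(g)$. (It is a skeleton of $C[\Sigma_{\mathfrak{P}_Y}^{-1}]$.) "Canonically" refers to the assignment $A_Z\mapsto Z$ on objects. *)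

theory Defs
  imports "HOL-Analysis.Analysis"
begin

section \<open>Categories\<close>

text \<open>\<open>Comp A g f\<close> is \<open>g\<close> after \<open>f\<close>.\<close>

record ('o, 'm) cat =
  Ob :: "'o set"
  Mor :: "'m set"
  Dom :: "'m \<Rightarrow> 'o"
  Cod :: "'m \<Rightarrow> 'o"
  Id :: "'o \<Rightarrow> 'm"
  Comp :: "'m \<Rightarrow> 'm \<Rightarrow> 'm"

definition Hom :: "('o, 'm) cat \<Rightarrow> 'o \<Rightarrow> 'o \<Rightarrow> 'm set" where
  "Hom A X Y = {f \<in> Mor A. Dom A f = X \<and> Cod A f = Y}"

locale category =
  fixes A :: "('o, 'm) cat"
  assumes Dom_in: "f \<in> Mor A \<Longrightarrow> Dom A f \<in> Ob A"
    and Cod_in: "f \<in> Mor A \<Longrightarrow> Cod A f \<in> Ob A"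
    and Id_in: "X \<in> Ob A \<Longrightarrow> Id A X \<in> Hom A X X"
    and Comp_in: "f \<in> Hom A X Y \<Longrightarrow> g \<in> Hom A Y Z \<Longrightarrow> Comp A g f \<in> Hom A X Z"
    and Id_left: "f \<in> Hom A X Y \<Longrightarrow> Comp A (Id A Y) f = f"
    and Id_right: "f \<in> Hom A X Y \<Longrightarrow> Comp A f (Id A X) = f"
    and Comp_assoc: "f \<in> Hom A W X \<Longrightarrow> g \<in> Hom A X Y \<Longrightarrow> h \<in> Hom A Y Z \<Longrightarrow>
      Comp A (Comp A h g) f = Comp A h (Comp A g f)"

locale cat_functor = A: category A + B: category B
  for A :: "('o1, 'm1) cat" and B :: "('o2, 'm2) cat" +
  fixes Fo :: "'o1 \<Rightarrow> 'o2" and Fm :: "'m1 \<Rightarrow> 'm2"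
  assumes obj_in: "X \<in> Ob A \<Longrightarrow> Fo X \<in> Ob B"
    and mor_in: "f \<in> Hom A X Y \<Longrightarrow> Fm f \<in> Hom B (Fo X) (Fo Y)"
    and map_Id: "X \<in> Ob A \<Longrightarrow> Fm (Id A X) = Id B (Fo X)"
    and map_Comp: "f \<in> Hom A X Y \<Longrightarrow> g \<in> Hom A Y Z \<Longrightarrow> Fm (Comp A g f) = Comp B (Fm g) (Fm f)"

definition cat_isomorphism ::
  "('o1, 'm1) cat \<Rightarrow> ('o2, 'm2) cat \<Rightarrow> ('o1 \<Rightarrow> 'o2) \<Rightarrow> ('m1 \<Rightarrow> 'm2) \<Rightarrow> bool" where
  "cat_isomorphism A B Fo Fm \<longleftrightarrow> cat_functor A B Fo Fm \<and>
    (\<exists>Go Gm. cat_functor B A Go Gm \<and>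
      (\<forall>X \<in> Ob A. Go (Fo X) = X) \<and> (\<forall>f \<in> Mor A. Gm (Fm f) = f) \<and>
      (\<forall>Y \<in> Ob B. Fo (Go Y) = Y) \<and> (\<forall>g \<in> Mor B. Fm (Gm g) = g))"

definition poset_cat :: "'a::order set \<Rightarrow> ('a, 'a \<times> 'a) cat" where
  "poset_cat S = \<lparr>Ob = S, Mor = {(U, V). U \<in> S \<and> V \<in> S \<and> U \<le> V}, Dom = fst, Cod = snd,
    Id = (\<lambda>U. (U, U)), Comp = (\<lambda>g f. (fst f, snd g))\<rparr>"

text \<open>The quotient of \<open>A\<close> that identifies parallel morphisms with equal image under \<open>\<Psi>\<close>.
  Morphisms of the quotient are equivalence classes; structure maps are induced from representatives.\<close>

definition par_rel :: "('o, 'm) cat \<Rightarrow> ('m \<Rightarrow> 'n) \<Rightarrow> ('m \<times> 'm) set" where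
  "par_rel A \<Psi> = {(f, g). f \<in> Mor A \<and> g \<in> Mor A \<and>
     Dom A f = Dom A g \<and> Cod A f = Cod A g \<and> \<Psi> f = \<Psi> g}"

definition quot_cat :: "('o, 'm) cat \<Rightarrow> ('m \<Rightarrow> 'n) \<Rightarrow> ('o, 'm set) cat" where
  "quot_cat A \<Psi> = \<lparr>Ob = Ob A, Mor = Mor A // par_rel A \<Psi>,
    Dom = (\<lambda>c. the_elem (Dom A ` c)), Cod = (\<lambda>c. the_elem (Cod A ` c)),
    Id = (\<lambda>X. par_rel A \<Psi> `` {Id A X}),
    Comp = (\<lambda>d c. \<Union>g\<in>d. \<Union>f\<in>c. par_rel A \<Psi> `` {Comp A g f})\<rparr>"


section \<open>Localization by a calculus of fractions\<close>

text \<open>A pair \<open>(f, s)\<close> with \<open>f : X \<rightarrow> Z\<close> and \<open>s : Y \<rightarrow> Z\<close> in \<open>S\<close> stands for the formal composite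
  \<open>s\<^sup>-\<^sup>1 f : X \<rightarrow> Y\<close>.\<close>

definition roofs :: "('o, 'm) cat \<Rightarrow> 'm set \<Rightarrow> ('m \<times> 'm) set" where
  "roofs A S = {(f, s). f \<in> Mor A \<and> s \<in> Mor A \<and> s \<in> S \<and> Cod A f = Cod A s}"

definition roof_rel :: "('o, 'm) cat \<Rightarrow> 'm set \<Rightarrow> (('m \<times> 'm) \<times> ('m \<times> 'm)) set" where
  "roof_rel A S = {((f, s), (f', s')). (f, s) \<in> roofs A S \<and> (f', s') \<in> roofs A S \<and>
     Dom A f = Dom A f' \<and> Dom A s = Dom A s' \<and>
     (\<exists>Z. \<exists>u \<in> Hom A (Cod A s) Z. \<exists>v \<in> Hom A (Cod A s') Z.
        Comp A u f = Comp A v f' \<and> Comp A u s = Comp A v s' \<and> Comp A u s \<in> S)}"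

text \<open>The class of \<open>(f, s)\<close>, that is, the morphism \<open>s\<^sup>-\<^sup>1 f\<close> of the localization.\<close>

definition frac :: "('o, 'm) cat \<Rightarrow> 'm set \<Rightarrow> 'm \<Rightarrow> 'm \<Rightarrow> ('m \<times> 'm) set" where
  "frac A S s f = roof_rel A S `` {(f, s)}"

text \<open>To compose \<open>s\<^sup>-\<^sup>1 f\<close> with \<open>t\<^sup>-\<^sup>1 g\<close>, complete \<open>s\<close> and \<open>g\<close> to a commutative square \<open>h s = s' g\<close>
  with \<open>s'\<close> in \<open>S\<close> (Ore condition); the composite is \<open>(s' t)\<^sup>-\<^sup>1 (h f)\<close>.\<close>

definition localization :: "('o, 'm) cat \<Rightarrow> 'm set \<Rightarrow> ('o, ('m \<times> 'm) set) cat" where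
  "localization A S = \<lparr>Ob = Ob A, Mor = roofs A S // roof_rel A S,
    Dom = (\<lambda>c. the_elem ((\<lambda>(f, s). Dom A f) ` c)),
    Cod = (\<lambda>c. the_elem ((\<lambda>(f, s). Dom A s) ` c)),
    Id = (\<lambda>X. frac A S (Id A X) (Id A X)),
    Comp = (\<lambda>d c. \<Union>{frac A S (Comp A s' t) (Comp A h f) | f s g t h s' W.
      (f, s) \<in> c \<and> (g, t) \<in> d \<and> h \<in> Hom A (Cod A s) W \<and> s' \<in> Hom A (Cod A g) W \<and>
      s' \<in> S \<and> Comp A h s = Comp A s' g})\<rparr>"


section \<open>Quivers and free categories\<close>

record ('v, 'e) quiver =
  verts :: "'v set"
  arrs :: "'e set"
  src :: "'e \<Rightarrow> 'v"
  tgt :: "'e \<Rightarrow> 'v"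

fun quiver_walk :: "('v, 'e) quiver \<Rightarrow> 'v \<Rightarrow> 'e list \<Rightarrow> 'v \<Rightarrow> bool" where
  "quiver_walk Q v [] w \<longleftrightarrow> v \<in> verts Q \<and> v = w"
| "quiver_walk Q v (a # as) w \<longleftrightarrow> v \<in> verts Q \<and> a \<in> arrs Q \<and> src Q a = v \<and> quiver_walk Q (tgt Q a) as w"

definition free_cat :: "('v, 'e) quiver \<Rightarrow> ('v, 'v \<times> 'e list \<times> 'v) cat" where
  "free_cat Q = \<lparr>Ob = verts Q, Mor = {(v, as, w). quiver_walk Q v as w},
    Dom = (\<lambda>(v, as, w). v), Cod = (\<lambda>(v, as, w). w),
    Id = (\<lambda>v. (v, [], v)),
    Comp = (\<lambda>(v', bs, w') (v, as, w). (v, as @ bs, w'))\<rparr>"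

text \<open>The morphism part of the functor on the free category extending \<open>\<phi>o\<close> on vertices
  and \<open>\<phi>a\<close> on arrows.\<close>

definition free_ext :: "('o, 'm) cat \<Rightarrow> ('v \<Rightarrow> 'o) \<Rightarrow> ('e \<Rightarrow> 'm) \<Rightarrow> 'v \<times> 'e list \<times> 'v \<Rightarrow> 'm" where
  "free_ext B \<phi>o \<phi>a = (\<lambda>(v, as, w). foldl (\<lambda>m a. Comp B (\<phi>a a) m) (Id B (\<phi>o v)) as)"


section \<open>Path categories\<close>

text \<open>The ambient lattice \<open>L\<close> is the whole type; its sublattice \<open>C\<close> is a set.\<close>

definition sublattice :: "'a::lattice set \<Rightarrow> bool" where
  "sublattice C \<longleftrightarrow> (\<forall>U \<in> C. \<forall>V \<in> C. inf U V \<in> C \<and> sup U V \<in> C)"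

text \<open>\<open>I 0, \<dots>, I n\<close> partition the unit interval into (nonempty, possibly degenerate) subintervals,
  listed in increasing order.\<close>

definition interval_partition :: "nat \<Rightarrow> (nat \<Rightarrow> real set) \<Rightarrow> bool" where
  "interval_partition n I \<longleftrightarrow> (\<Union>i\<le>n. I i) = {0..1} \<and>
    (\<forall>i\<le>n. I i \<noteq> {} \<and> is_interval (I i)) \<and>
    (\<forall>i j. i < j \<and> j \<le> n \<longrightarrow> (\<forall>x \<in> I i. \<forall>y \<in> I j. x < y))"

definition paths :: "'a::order set \<Rightarrow> (real \<Rightarrow> 'a) set" where
  "paths C = {\<gamma> \<in> extensional {0..1}.
     \<exists>n\<ge>1. \<exists>I U. interval_partition n I \<and> (\<forall>i\<le>n. U i \<in> C) \<and> (\<forall>i<n. U i \<le> U (Suc i)) \<and>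
       (\<forall>i\<le>n. \<forall>t \<in> I i. \<gamma> t = U i)}"

definition path_rel :: "'a::order set \<Rightarrow> ((real \<Rightarrow> 'a) \<times> (real \<Rightarrow> 'a)) set" where
  "path_rel C = {(\<gamma>, \<gamma>'). \<gamma> \<in> paths C \<and> \<gamma>' \<in> paths C \<and> \<gamma> 0 = \<gamma>' 0 \<and> \<gamma> 1 = \<gamma>' 1}"

abbreviation path_class :: "'a::order set \<Rightarrow> (real \<Rightarrow> 'a) \<Rightarrow> (real \<Rightarrow> 'a) set" where
  "path_class C \<gamma> \<equiv> path_rel C `` {\<gamma>}"

definition concat_path :: "(real \<Rightarrow> 'a) \<Rightarrow> (real \<Rightarrow> 'a) \<Rightarrow> real \<Rightarrow> 'a" where
  "concat_path \<gamma> \<gamma>' = (\<lambda>t \<in> {0..1}. if t \<le> 1/2 then \<gamma> (2 * t) else \<gamma>' (2 * t - 1))"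

definition path_cat :: "'a::order set \<Rightarrow> ('a, (real \<Rightarrow> 'a) set) cat" where
  "path_cat C = \<lparr>Ob = C, Mor = paths C // path_rel C,
    Dom = (\<lambda>c. the_elem ((\<lambda>\<gamma>. \<gamma> 0) ` c)), Cod = (\<lambda>c. the_elem ((\<lambda>\<gamma>. \<gamma> 1) ` c)),
    Id = (\<lambda>U. path_class C (\<lambda>t \<in> {0..1}. U)),
    Comp = (\<lambda>d c. \<Union>\<gamma>'\<in>d. \<Union>\<gamma>\<in>c. path_class C (concat_path \<gamma> \<gamma>'))\<rparr>"


section \<open>Pixels and pixelation\<close>

definition pixel :: "'a::lattice set \<Rightarrow> 'a \<Rightarrow> 'a \<Rightarrow> 'a set" where
  "pixel C Y Z = {U \<in> C. inf U Y = Z}"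

definition pixels :: "'a::lattice set \<Rightarrow> 'a \<Rightarrow> 'a set set" where
  "pixels C Y = {pixel C Y Z | Z. Z \<le> Y \<and> pixel C Y Z \<noteq> {}}"

definition pixel_morphisms :: "'a::order set \<Rightarrow> 'a set set \<Rightarrow> (real \<Rightarrow> 'a) set set" where
  "pixel_morphisms C P = {path_class C \<rho> | \<rho>. \<rho> \<in> paths C \<and> (\<exists>X \<in> P. \<rho> ` {0..1} \<subseteq> X)}"

definition pixelation :: "'a::order set \<Rightarrow> 'a set set \<Rightarrow>
    ('a, ((real \<Rightarrow> 'a) set \<times> (real \<Rightarrow> 'a) set) set) cat" where
  "pixelation C P = localization (path_cat C) (pixel_morphisms C P)"

definition pseudo_arrows :: "'a::order set \<Rightarrow> 'a set set \<Rightarrow>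
    ((real \<Rightarrow> 'a) set \<times> (real \<Rightarrow> 'a) set) set set" where
  "pseudo_arrows C P = {frac (path_cat C) (pixel_morphisms C P) (path_class C \<rho>) (path_class C \<gamma>) | \<rho> \<gamma>.
     \<rho> \<in> paths C \<and> \<gamma> \<in> paths C \<and> path_class C \<rho> \<in> pixel_morphisms C P \<and> \<rho> 1 = \<gamma> 1 \<and>
     (\<exists>I. interval_partition 1 I \<and>
       (\<exists>X \<in> P. \<exists>X' \<in> P. X \<noteq> X' \<and> \<gamma> ` I 0 \<subseteq> X \<and> \<gamma> ` I 1 \<subseteq> X'))}"

text \<open>\<open>s X\<close> is the chosen element of the pixel \<open>X\<close>.\<close>

definition pixel_quiver :: "'a::order set \<Rightarrow> 'a set set \<Rightarrow> ('a set \<Rightarrow> 'a) \<Rightarrow>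
    ('a set, 'a set \<times> ((real \<Rightarrow> 'a) set \<times> (real \<Rightarrow> 'a) set) set \<times> 'a set) quiver" where
  "pixel_quiver C P s = \<lparr>verts = P,
    arrs = {(X, m, X'). X \<in> P \<and> X' \<in> P \<and> m \<in> pseudo_arrows C P \<and> m \<in> Hom (pixelation C P) (s X) (s X')},
    src = (\<lambda>(X, m, X'). X), tgt = (\<lambda>(X, m, X'). X')\<rparr>"

definition pixel_quiver_cat where
  "pixel_quiver_cat C P s = quot_cat (free_cat (pixel_quiver C P s))
     (free_ext (pixelation C P) s (\<lambda>(X, m, X'). m))"

definition meet_lattice :: "'a::lattice set \<Rightarrow> 'a \<Rightarrow> 'a set" where
  "meet_lattice C Y = {inf U Y | U. U \<in> C}"

lemma sublattice_meet_lattice: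
  fixes C :: "'a::distrib_lattice set"
  assumes "sublattice C"
  shows "sublattice (meet_lattice C Y)"
proof -
  have "\<exists>W. inf (inf U Y) (inf V Y) = inf W Y \<and> W \<in> C" if "U \<in> C" "V \<in> C" for U V
    using assms that unfolding sublattice_def
    by (intro exI[of _ "inf U V"]) (simp add: inf_assoc inf_left_commute)
  moreover have "\<exists>W. sup (inf U Y) (inf V Y) = inf W Y \<and> W \<in> C" if "U \<in> C" "V \<in> C" for U V
    using assms that unfolding sublattice_def
    by (intro exI[of _ "sup U V"]) (simp add: inf_sup_distrib2)
  ultimately show ?thesis
    unfolding sublattice_def meet_lattice_def by blast
qed

end

theory Submission
  imports Defs
begin

text \<open>Every category involved is thin. In the path category there is a morphism \<open>U \<rightarrow> V\<close> iff
  \<open>U \<le> V\<close>. In the localization there is one iff \<open>U \<sqinter> Y \<le> V \<sqinter> Y\<close>: the roof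
  \<open>U \<le> U \<squnion> V \<ge> V\<close> is admissible because \<open>(U \<squnion> V) \<sqinter> Y = V \<sqinter> Y\<close> by distributivity, and
  two roofs between the same objects are equalized by the join of their tips. Hence parallel walks in
  the quiver are identified, and between two distinct pixels there is an arrow whenever the
  localization has a morphism between the chosen elements.\<close>

section \<open>Thin categories\<close>

definition thin :: "('o, 'm) cat \<Rightarrow> bool" where
  "thin A \<longleftrightarrow> (\<forall>X Y. \<forall>f \<in> Hom A X Y. \<forall>g \<in> Hom A X Y. f = g)"

lemma thinD: "thin A \<Longrightarrow> f \<in> Hom A X Y \<Longrightarrow> g \<in> Hom A X Y \<Longrightarrow> f = g"
  unfolding thin_def by blast

text \<open>The two sides of a unit or associativity law are parallel morphisms, so thinness makes
  them equal. What remains is that identities and composites have the right ends.\<close>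

lemma thin_category:
  assumes thin: "thin A"
    and dom: "\<And>f. f \<in> Mor A \<Longrightarrow> Dom A f \<in> Ob A"
    and cod: "\<And>f. f \<in> Mor A \<Longrightarrow> Cod A f \<in> Ob A"
    and ident: "\<And>X. X \<in> Ob A \<Longrightarrow> Id A X \<in> Hom A X X"
    and comp: "\<And>X Y Z f g. f \<in> Hom A X Y \<Longrightarrow> g \<in> Hom A Y Z \<Longrightarrow> Comp A g f \<in> Hom A X Z"
  shows "category A"
proof
  have ob: "X \<in> Ob A \<and> Y \<in> Ob A" if "f \<in> Hom A X Y" for f X Y
    using that dom cod by (auto simp: Hom_def)
  show "Comp A (Id A Y) f = f" if f: "f \<in> Hom A X Y" for f X Y
    using thinD[OF thin comp[OF f ident] f] ob[OF f] by simp
  show "Comp A f (Id A X) = f" if f: "f \<in> Hom A X Y" for f X Y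
    using thinD[OF thin comp[OF ident f] f] ob[OF f] by simp
  show "Comp A (Comp A h g) f = Comp A h (Comp A g f)"
    if "f \<in> Hom A W X" "g \<in> Hom A X Y" "h \<in> Hom A Y Z" for f g h W X Y Z
    using that by (intro thinD[OF thin]) (blast intro: comp)+
qed (use dom cod ident comp in auto)

section \<open>Posets as thin categories\<close>

lemma Hom_poset_cat:
  "Hom (poset_cat S) U V = (if U \<in> S \<and> V \<in> S \<and> U \<le> V then {(U, V)} else {})"
  by (auto simp: Hom_def poset_cat_def)

lemma category_poset_cat: "category (poset_cat S)"
proof (rule thin_category)
  show "thin (poset_cat S)"
    by (auto simp: thin_def Hom_poset_cat split: if_splits)
qed (auto simp: Hom_def poset_cat_def)

text \<open>A thin category is determined by its objects and by which hom-sets are nonempty. A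
  bijection on objects that turns the latter relation into \<open>\<le>\<close> therefore extends to
  an isomorphism; thinness yields the laws of the inverse functor and that it undoes the given
  one.\<close>

lemma thin_isomorphic_poset_cat:
  assumes cat: "category A" and thin: "thin A"
    and bij: "bij_betw Fo (Ob A) S"
    and hom: "\<And>X X'. X \<in> Ob A \<Longrightarrow> X' \<in> Ob A \<Longrightarrow> Hom A X X' \<noteq> {} \<longleftrightarrow> Fo X \<le> Fo X'"
  shows "cat_isomorphism A (poset_cat S) Fo (\<lambda>f. (Fo (Dom A f), Fo (Cod A f)))"
proof -
  interpret A: category A by (fact cat)
  interpret B: category "poset_cat S" by (fact category_poset_cat)
  define Go where "Go = inv_into (Ob A) Fo"
  have Go_Fo: "Go (Fo X) = X" if "X \<in> Ob A" for X
    unfolding Go_def using bij that by (simp add: bij_betw_inv_into_left)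
  have Fo_Go: "Fo (Go U) = U" if "U \<in> S" for U
    unfolding Go_def using bij that by (simp add: bij_betw_inv_into_right)
  have Fo_in: "Fo X \<in> S" if "X \<in> Ob A" for X
    using bij that by (auto simp: bij_betw_def)
  have Go_in: "Go U \<in> Ob A" if "U \<in> S" for U
    using bij that by (metis Go_def bij_betw_def inv_into_into)
  have Hom_Ob: "X \<in> Ob A \<and> X' \<in> Ob A" if "f \<in> Hom A X X'" for f X X'
    using that A.Dom_in A.Cod_in by (auto simp: Hom_def)
  \<comment> \<open>The choice is harmless: for \<open>U \<le> V\<close> the hom-set is nonempty by
    \<open>hom\<close>, and by thinness it has only one element.\<close>
  define Gm where "Gm = (\<lambda>(U, V). SOME f. f \<in> Hom A (Go U) (Go V))"
  have Gm_in: "Gm (U, V) \<in> Hom A (Go U) (Go V)" if "U \<in> S" "V \<in> S" "U \<le> V" for U V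
  proof -
    have "Hom A (Go U) (Go V) \<noteq> {}"
      using that hom Fo_Go Go_in by simp
    then show ?thesis
      unfolding Gm_def by (simp add: some_in_eq)
  qed
  have F: "cat_functor A (poset_cat S) Fo (\<lambda>f. (Fo (Dom A f), Fo (Cod A f)))"
  proof
    show "Fo X \<in> Ob (poset_cat S)" if "X \<in> Ob A" for X
      using Fo_in[OF that] by (simp add: poset_cat_def)
    show "(Fo (Dom A f), Fo (Cod A f)) \<in> Hom (poset_cat S) (Fo X) (Fo X')"
      if "f \<in> Hom A X X'" for f X X'
    proof -
      have "Fo X \<le> Fo X'" "X \<in> Ob A" "X' \<in> Ob A"
        using hom Hom_Ob that by blast+
      then show ?thesis
        using that Fo_in unfolding Hom_poset_cat by (simp add: Hom_def)
    qed
    show "(Fo (Dom A (Id A X)), Fo (Cod A (Id A X))) = Id (poset_cat S) (Fo X)" if "X \<in> Ob A" for X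
      using A.Id_in[OF that] by (simp add: Hom_def poset_cat_def)
    show "(Fo (Dom A (Comp A g f)), Fo (Cod A (Comp A g f))) =
        Comp (poset_cat S) (Fo (Dom A g), Fo (Cod A g)) (Fo (Dom A f), Fo (Cod A f))"
      if "f \<in> Hom A X X'" "g \<in> Hom A X' X''" for f g X X' X''
      using A.Comp_in[OF that] that by (simp add: Hom_def poset_cat_def)
  qed
  have G: "cat_functor (poset_cat S) A Go Gm"
  proof
    show "Go U \<in> Ob A" if "U \<in> Ob (poset_cat S)" for U
      using that Go_in by (simp add: poset_cat_def)
    show Gm_Hom: "Gm f \<in> Hom A (Go U) (Go V)" if "f \<in> Hom (poset_cat S) U V" for f U V
      using that Gm_in by (simp add: Hom_poset_cat split: if_splits)
    show "Gm (Id (poset_cat S) U) = Id A (Go U)" if "U \<in> Ob (poset_cat S)" for U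
    proof (rule thinD[OF thin])
      show "Gm (Id (poset_cat S) U) \<in> Hom A (Go U) (Go U)"
        by (intro Gm_Hom B.Id_in that)
      show "Id A (Go U) \<in> Hom A (Go U) (Go U)"
        using that Go_in A.Id_in by (simp add: poset_cat_def)
    qed
    show "Gm (Comp (poset_cat S) g f) = Comp A (Gm g) (Gm f)"
      if "f \<in> Hom (poset_cat S) U V" "g \<in> Hom (poset_cat S) V W" for f g U V W
      by (rule thinD[OF thin Gm_Hom[OF B.Comp_in[OF that]]
            A.Comp_in[OF Gm_Hom[OF that(1)] Gm_Hom[OF that(2)]]])
  qed
  have GF: "Gm (Fo (Dom A f), Fo (Cod A f)) = f" if "f \<in> Mor A" for f
  proof (rule thinD[OF thin])
    show f: "f \<in> Hom A (Dom A f) (Cod A f)"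
      using that by (simp add: Hom_def)
    have "Fo (Dom A f) \<le> Fo (Cod A f)"
      using hom Hom_Ob f by blast
    then show "Gm (Fo (Dom A f), Fo (Cod A f)) \<in> Hom A (Dom A f) (Cod A f)"
      using Gm_in[of "Fo (Dom A f)" "Fo (Cod A f)"] Fo_in Go_Fo Hom_Ob[OF f] by simp
  qed
  have FG: "(Fo (Dom A (Gm g)), Fo (Cod A (Gm g))) = g" if g_in: "g \<in> Mor (poset_cat S)" for g
  proof -
    obtain U V where g: "g = (U, V)" "U \<in> S" "V \<in> S" "U \<le> V"
      using g_in by (auto simp: poset_cat_def)
    then show ?thesis
      using Gm_in[of U V] Fo_Go by (auto simp: Hom_def)
  qed
  show ?thesis
    unfolding cat_isomorphism_def
    by (intro conjI exI[of _ Go] exI[of _ Gm] ballI F G Go_Fo GF FG)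
      (simp_all add: Fo_Go poset_cat_def)
qed

section \<open>Quotients and free categories\<close>

text \<open>The situation of the pixel quiver: walks are sent to a thin category, so their image
  depends only on their ends.\<close>

locale collapse = category A for A :: "('o, 'm) cat" +
  fixes \<Psi> :: "'m \<Rightarrow> 'n"
  assumes collapse: "f \<in> Hom A X Y \<Longrightarrow> g \<in> Hom A X Y \<Longrightarrow> \<Psi> f = \<Psi> g"
begin

text \<open>Parallel morphisms are always related here, so the classes are exactly the nonempty
  hom-sets. The structure maps of the quotient are computed from this description.\<close>

lemma par_class:
  assumes f: "f \<in> Hom A X Y"
  shows "par_rel A \<Psi> `` {f} = Hom A X Y"
proof (intro set_eqI iffI)
  show "g \<in> Hom A X Y" if "g \<in> par_rel A \<Psi> `` {f}" for g
    using f that by (simp add: par_rel_def Hom_def)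
  show "g \<in> par_rel A \<Psi> `` {f}" if g: "g \<in> Hom A X Y" for g
  proof -
    have "\<Psi> f = \<Psi> g"
      using collapse[OF f g] .
    then show ?thesis
      using f g by (simp add: par_rel_def Hom_def)
  qed
qed

lemma Mor_quot: "Mor (quot_cat A \<Psi>) = {Hom A X Y | X Y. Hom A X Y \<noteq> {}}"
proof (intro set_eqI iffI)
  fix c assume "c \<in> Mor (quot_cat A \<Psi>)"
  then obtain f where f: "f \<in> Mor A" "c = par_rel A \<Psi> `` {f}"
    by (auto simp: quot_cat_def elim: quotientE)
  have "f \<in> Hom A (Dom A f) (Cod A f)"
    using f(1) by (simp add: Hom_def)
  then show "c \<in> {Hom A X Y | X Y. Hom A X Y \<noteq> {}}"
    using f(2) par_class by blast
next
  fix c assume "c \<in> {Hom A X Y | X Y. Hom A X Y \<noteq> {}}"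
  then obtain X Y f where "c = Hom A X Y" and f: "f \<in> Hom A X Y"
    by blast
  then have "c = par_rel A \<Psi> `` {f}"
    using par_class by simp
  then show "c \<in> Mor (quot_cat A \<Psi>)"
    using f by (simp add: quot_cat_def Hom_def quotientI)
qed

lemma quot_Dom_Cod:
  assumes "Hom A X Y \<noteq> {}"
  shows "Dom (quot_cat A \<Psi>) (Hom A X Y) = X" "Cod (quot_cat A \<Psi>) (Hom A X Y) = Y"
proof -
  have "Dom A ` Hom A X Y = {X}" "Cod A ` Hom A X Y = {Y}"
    using assms by (auto simp: Hom_def)
  then show "Dom (quot_cat A \<Psi>) (Hom A X Y) = X" "Cod (quot_cat A \<Psi>) (Hom A X Y) = Y"
    by (simp_all add: quot_cat_def)
qed

lemma Hom_quot: "Hom (quot_cat A \<Psi>) X Y = (if Hom A X Y = {} then {} else {Hom A X Y})"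
proof (intro set_eqI iffI)
  fix c assume "c \<in> Hom (quot_cat A \<Psi>) X Y"
  then have "c \<in> Mor (quot_cat A \<Psi>)" and XY: "Dom (quot_cat A \<Psi>) c = X" "Cod (quot_cat A \<Psi>) c = Y"
    by (auto simp: Hom_def)
  then obtain X' Y' where c: "c = Hom A X' Y'" "Hom A X' Y' \<noteq> {}"
    unfolding Mor_quot by blast
  then show "c \<in> (if Hom A X Y = {} then {} else {Hom A X Y})"
    using XY quot_Dom_Cod[OF c(2)] by simp
next
  fix c assume "c \<in> (if Hom A X Y = {} then {} else {Hom A X Y})"
  then have "c = Hom A X Y" "Hom A X Y \<noteq> {}"
    by (auto split: if_splits)
  moreover from this have "c \<in> Mor (quot_cat A \<Psi>)"
    unfolding Mor_quot by blast
  ultimately show "c \<in> Hom (quot_cat A \<Psi>) X Y"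
    using quot_Dom_Cod by (simp add: Hom_def[of "quot_cat A \<Psi>"])
qed

lemma quot_thin: "thin (quot_cat A \<Psi>)"
  by (auto simp: thin_def Hom_quot)

lemma quot_category: "category (quot_cat A \<Psi>)"
proof (rule thin_category[OF quot_thin])
  fix c assume "c \<in> Mor (quot_cat A \<Psi>)"
  then obtain X Y where c: "c = Hom A X Y" "Hom A X Y \<noteq> {}"
    unfolding Mor_quot by blast
  then have "X \<in> Ob A" "Y \<in> Ob A"
    using Dom_in Cod_in by (auto simp: Hom_def)
  then show "Dom (quot_cat A \<Psi>) c \<in> Ob (quot_cat A \<Psi>)" "Cod (quot_cat A \<Psi>) c \<in> Ob (quot_cat A \<Psi>)"
    using quot_Dom_Cod[OF c(2)] c(1) by (simp_all add: quot_cat_def)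
next
  fix X assume "X \<in> Ob (quot_cat A \<Psi>)"
  then have "Id A X \<in> Hom A X X"
    using Id_in by (simp add: quot_cat_def)
  moreover from this have "Id (quot_cat A \<Psi>) X = Hom A X X"
    using par_class by (simp add: quot_cat_def)
  ultimately show "Id (quot_cat A \<Psi>) X \<in> Hom (quot_cat A \<Psi>) X X"
    by (auto simp: Hom_quot)
next
  fix X Y Z c d assume "c \<in> Hom (quot_cat A \<Psi>) X Y" "d \<in> Hom (quot_cat A \<Psi>) Y Z"
  then have cd: "c = Hom A X Y" "d = Hom A Y Z" "Hom A X Y \<noteq> {}" "Hom A Y Z \<noteq> {}"
    by (auto simp: Hom_quot split: if_splits)
  \<comment> \<open>Every choice of representatives gives the same class, so the union that defines
    the composite runs over a constant family, nonempty because \<open>c\<close> and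
    \<open>d\<close> are.\<close>
  have *: "par_rel A \<Psi> `` {Comp A g f} = Hom A X Z" if "f \<in> c" "g \<in> d" for f g
    using that cd(1,2) par_class Comp_in by simp
  have "Comp (quot_cat A \<Psi>) d c = (\<Union>g\<in>d. \<Union>f\<in>c. Hom A X Z)"
    using * by (simp add: quot_cat_def)
  also have "\<dots> = Hom A X Z"
    using cd by auto
  finally have "Comp (quot_cat A \<Psi>) d c = Hom A X Z" .
  moreover obtain f g where "f \<in> Hom A X Y" "g \<in> Hom A Y Z"
    using cd by blast
  then have "Hom A X Z \<noteq> {}"
    using Comp_in by blast
  ultimately show "Comp (quot_cat A \<Psi>) d c \<in> Hom (quot_cat A \<Psi>) X Z"
    by (simp add: Hom_quot)
qed

end

section \<open>Free categories and the extension of a quiver map to walks\<close>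

lemma quiver_walk_append:
  "quiver_walk Q u as v \<Longrightarrow> quiver_walk Q v bs w \<Longrightarrow> quiver_walk Q u (as @ bs) w"
  by (induction as arbitrary: u) auto

lemma quiver_walk_verts: "quiver_walk Q v as w \<Longrightarrow> v \<in> verts Q \<and> w \<in> verts Q"
  by (induction as arbitrary: v) auto

lemma Hom_free_cat: "Hom (free_cat Q) v w = {(v, as, w) | as. quiver_walk Q v as w}"
  by (auto simp: Hom_def free_cat_def)

lemma category_free_cat: "category (free_cat Q)"
proof
  show "Comp (free_cat Q) g f \<in> Hom (free_cat Q) u w"
    if "f \<in> Hom (free_cat Q) u v" "g \<in> Hom (free_cat Q) v w" for f g u v w
    using that by (auto simp: Hom_free_cat) (auto simp: free_cat_def intro: quiver_walk_append)
  show "Dom (free_cat Q) f \<in> Ob (free_cat Q)" "Cod (free_cat Q) f \<in> Ob (free_cat Q)"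
    if "f \<in> Mor (free_cat Q)" for f
    using that quiver_walk_verts[of Q "fst f" "fst (snd f)" "snd (snd f)"]
    by (auto simp: free_cat_def)
qed (auto simp: Hom_free_cat, auto simp: free_cat_def)

lemma free_ext_in_Hom:
  assumes B: "category B"
    and verts: "\<And>v. v \<in> verts Q \<Longrightarrow> \<phi>o v \<in> Ob B"
    and arrs: "\<And>a. a \<in> arrs Q \<Longrightarrow> \<phi>a a \<in> Hom B (\<phi>o (src Q a)) (\<phi>o (tgt Q a))"
    and f: "f \<in> Hom (free_cat Q) v w"
  shows "free_ext B \<phi>o \<phi>a f \<in> Hom B (\<phi>o v) (\<phi>o w)"
proof -
  interpret B: category B by (fact B)
  obtain as where as: "f = (v, as, w)" "quiver_walk Q v as w"
    using f by (auto simp: Hom_free_cat)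
  \<comment> \<open>The accumulator changes along the fold, so the induction allows any morphism
    \<open>m\<close> into the image of the current vertex; \<open>free_ext\<close> is the case where
    \<open>m\<close> is an identity.\<close>
  have "foldl (\<lambda>m a. Comp B (\<phi>a a) m) m as \<in> Hom B x (\<phi>o w)"
    if "quiver_walk Q u as w" "m \<in> Hom B x (\<phi>o u)" for u x m
    using that
  proof (induction as arbitrary: u m)
    case (Cons a as)
    then have a: "a \<in> arrs Q" "src Q a = u" "quiver_walk Q (tgt Q a) as w"
      by auto
    then have "Comp B (\<phi>a a) m \<in> Hom B x (\<phi>o (tgt Q a))"
      using B.Comp_in[OF Cons.prems(2)] arrs by blast
    then show ?case
      using Cons.IH a(3) by simp
  qed simp
  moreover have "Id B (\<phi>o v) \<in> Hom B (\<phi>o v) (\<phi>o v)"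
    using quiver_walk_verts[OF as(2)] verts B.Id_in by blast
  ultimately show ?thesis
    using as by (simp add: free_ext_def)
qed

section \<open>The path category\<close>

text \<open>A monotone index function replaces the intervals: \<open>k t\<close> is the index of the interval that
  contains \<open>t\<close>. Concatenation of paths is easier to express in this form.\<close>

definition path_index ::
    "'a::order set \<Rightarrow> (real \<Rightarrow> 'a) \<Rightarrow> nat \<Rightarrow> (real \<Rightarrow> nat) \<Rightarrow> (nat \<Rightarrow> 'a) \<Rightarrow> bool" where
  "path_index C \<gamma> n k U \<longleftrightarrow> n \<ge> 1 \<and> mono_on {0..1} k \<and> k ` {0..1} = {..n} \<and>
     mono_on {..n} U \<and> U ` {..n} \<subseteq> C \<and> (\<forall>t\<in>{0..1}. \<gamma> t = U (k t))"

text \<open>Intervals and index functions determine each other: the intervals are the fibres of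
  \<open>k\<close>. Their order corresponds to monotonicity of \<open>k\<close>, and their being
  nonempty to surjectivity onto \<open>{..n}\<close>.\<close>

lemma paths_iff_index:
  "\<gamma> \<in> paths C \<longleftrightarrow> \<gamma> \<in> extensional {0..1} \<and> (\<exists>n k U. path_index C \<gamma> n k U)"
proof
  assume "\<gamma> \<in> paths C"
  then obtain n I U where ext: "\<gamma> \<in> extensional {0..1}" and n: "n \<ge> 1"
    and I: "interval_partition n I" and U: "\<forall>i\<le>n. U i \<in> C" "\<forall>i<n. U i \<le> U (Suc i)"
    and \<gamma>: "\<forall>i\<le>n. \<forall>t \<in> I i. \<gamma> t = U i"
    unfolding paths_def by blast
  have cover: "(\<Union>i\<le>n. I i) = {0..1}" and ne: "\<And>i. i \<le> n \<Longrightarrow> I i \<noteq> {}"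
    and ord: "\<And>i j x y. i < j \<Longrightarrow> j \<le> n \<Longrightarrow> x \<in> I i \<Longrightarrow> y \<in> I j \<Longrightarrow> x < y"
    using I unfolding interval_partition_def by auto
  have "\<forall>t\<in>{0..1}. \<exists>i. i \<le> n \<and> t \<in> I i"
    using cover by blast
  then obtain k where k: "\<forall>t\<in>{0..1}. k t \<le> n \<and> t \<in> I (k t)"
    by metis
  \<comment> \<open>The strict order between the intervals makes them disjoint, so the index picked
    by \<open>k\<close> is the only possible one.\<close>
  have k_eq: "k t = i" if "i \<le> n" "t \<in> I i" for t i
  proof -
    have "t \<in> {0..1}"
      using that cover by blast
    then show ?thesis
      using k ord that by (metis less_irrefl nat_neq_iff)
  qed
  have "mono_on {0..1} k"
    using k ord by (intro mono_onI) (meson leD leI)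
  moreover have "k ` {0..1} = {..n}"
  proof
    show "k ` {0..1} \<subseteq> {..n}"
      using k by auto
    show "{..n} \<subseteq> k ` {0..1}"
    proof
      fix i assume i: "i \<in> {..n}"
      then obtain t where "t \<in> I i"
        using ne by blast
      then show "i \<in> k ` {0..1}"
        using i cover k_eq by (intro image_eqI[of _ _ t]) auto
    qed
  qed
  moreover have "mono_on {..n} U"
  proof (intro mono_onI)
    fix i j assume "i \<in> {..n}" "j \<in> {..n}" "i \<le> j"
    from this(3,2) show "U i \<le> U j"
      using U(2) by (induction rule: dec_induct) (auto intro: order_trans)
  qed
  moreover have "U ` {..n} \<subseteq> C" "\<forall>t\<in>{0..1}. \<gamma> t = U (k t)"
    using U(1) k \<gamma> by auto
  ultimately have "path_index C \<gamma> n k U"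
    using n by (simp add: path_index_def)
  then show "\<gamma> \<in> extensional {0..1} \<and> (\<exists>n k U. path_index C \<gamma> n k U)"
    using ext by blast
next
  assume "\<gamma> \<in> extensional {0..1} \<and> (\<exists>n k U. path_index C \<gamma> n k U)"
  then obtain n k U where ext: "\<gamma> \<in> extensional {0..1}" and "path_index C \<gamma> n k U"
    by blast
  then have n: "n \<ge> 1" and k: "mono_on {0..1} k" "k ` {0..1} = {..n}"
    and U: "mono_on {..n} U" "U ` {..n} \<subseteq> C" and \<gamma>: "\<forall>t\<in>{0..1}. \<gamma> t = U (k t)"
    by (simp_all add: path_index_def)
  define I where "I = (\<lambda>i. {t::real. t \<in> {0..1} \<and> k t = i})"
  have "interval_partition n I"
    unfolding interval_partition_def
  proof (intro conjI allI impI ballI)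
    show "(\<Union>i\<le>n. I i) = {0..1}"
      using k(2) by (auto simp: I_def)
    show "I i \<noteq> {}" if "i \<le> n" for i
    proof -
      have "i \<in> k ` {0..1}"
        using that k(2) by simp
      then show ?thesis
        by (auto simp: I_def)
    qed
    show "is_interval (I i)" for i
      unfolding is_interval_1
    proof (intro ballI allI impI)
      fix a b x assume "a \<in> I i" "b \<in> I i" "a \<le> x \<and> x \<le> b"
      moreover from this have "k a \<le> k x" "k x \<le> k b"
        using mono_onD[OF k(1), of a x] mono_onD[OF k(1), of x b] by (auto simp: I_def)
      ultimately show "x \<in> I i"
        by (auto simp: I_def)
    qed
    show "x < y" if "i < j \<and> j \<le> n" "x \<in> I i" "y \<in> I j" for i j x y
    proof (rule ccontr)
      assume "\<not> x < y"
      then have "k y \<le> k x"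
        using that mono_onD[OF k(1), of y x] by (auto simp: I_def)
      then show False
        using that by (simp add: I_def)
    qed
  qed
  moreover have "\<forall>i\<le>n. U i \<in> C" "\<forall>i<n. U i \<le> U (Suc i)" "\<forall>i\<le>n. \<forall>t \<in> I i. \<gamma> t = U i"
    using U(2) \<gamma> by (auto simp: I_def intro!: mono_onD[OF U(1)])
  ultimately show "\<gamma> \<in> paths C"
    unfolding paths_def using ext n by blast
qed

lemma path_mono: "\<gamma> \<in> paths C \<Longrightarrow> mono_on {0..1} \<gamma>"
  unfolding paths_iff_index path_index_def
proof (elim conjE exE)
  fix n k U
  assume k: "mono_on {0..1::real} k" "k ` {0..1} = {..n::nat}"
    and U: "mono_on {..n} U" and \<gamma>: "\<forall>t\<in>{0..1}. \<gamma> t = U (k t)"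
  show "mono_on {0..1} \<gamma>"
  proof (rule mono_onI)
    fix t t' :: real assume t: "t \<in> {0..1}" "t' \<in> {0..1}" "t \<le> t'"
    then have "k t \<le> k t'" "k t \<in> {..n}" "k t' \<in> {..n}"
      using mono_onD[OF k(1)] k(2) by blast+
    then show "\<gamma> t \<le> \<gamma> t'"
      using \<gamma> t mono_onD[OF U] by simp
  qed
qed

lemma path_in: "\<gamma> \<in> paths C \<Longrightarrow> t \<in> {0..1} \<Longrightarrow> \<gamma> t \<in> C"
  unfolding paths_iff_index path_index_def by (elim conjE exE) (metis imageI subsetD)

text \<open>The witness for all existence claims about paths: a single jump just after 1/2, or the
  constant path if both values agree.\<close>

definition step_path :: "'a \<Rightarrow> 'a \<Rightarrow> real \<Rightarrow> 'a" where
  "step_path U V = (\<lambda>t \<in> {0..1}. if t \<le> 1/2 then U else V)"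

lemma step_path_in:
  assumes "U \<in> C" "V \<in> C" "U \<le> V"
  shows "step_path U V \<in> paths C"
  unfolding paths_iff_index path_index_def
proof (intro conjI exI)
  let ?k = "\<lambda>t::real. if t \<le> 1/2 then 0 else 1::nat"
  show "?k ` {0..1} = {..1}"
  proof
    have "?k 0 = 0" "?k 1 = 1"
      by auto
    then show "{..1} \<subseteq> ?k ` {0..1}"
      by (auto simp: atMost_Suc intro: image_eqI[of _ _ 0] image_eqI[of _ _ 1])
  qed auto
  show "mono_on {..1} (\<lambda>i::nat. if i = 0 then U else V)"
    using assms by (auto intro!: mono_onI)
qed (use assms in \<open>auto simp: step_path_def intro!: mono_onI\<close>)

lemma step_path_ends: "step_path U V 0 = U" "step_path U V 1 = V"
  by (simp_all add: step_path_def)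

text \<open>The two index functions are glued, with the last index of \<open>\<gamma>\<close> and
  the first index of \<open>\<gamma>'\<close> merged into one. The values there agree by
  \<open>eq\<close>.\<close>

lemma concat_path_in:
  assumes \<gamma>: "\<gamma> \<in> paths C" and \<gamma>': "\<gamma>' \<in> paths C" and eq: "\<gamma> 1 = \<gamma>' 0"
  shows "concat_path \<gamma> \<gamma>' \<in> paths C"
proof -
  obtain n k U where "path_index C \<gamma> n k U"
    using \<gamma> unfolding paths_iff_index by blast
  then have n: "n \<ge> 1" and k: "mono_on {0..1} k" "k ` {0..1} = {..n}"
    and U: "mono_on {..n} U" "U ` {..n} \<subseteq> C" and \<gamma>_eq: "\<forall>t\<in>{0..1}. \<gamma> t = U (k t)"
    by (simp_all add: path_index_def)
  obtain n' k' U' where "path_index C \<gamma>' n' k' U'"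
    using \<gamma>' unfolding paths_iff_index by blast
  then have k': "mono_on {0..1} k'" "k' ` {0..1} = {..n'}"
    and U': "mono_on {..n'} U'" "U' ` {..n'} \<subseteq> C" and \<gamma>'_eq: "\<forall>t\<in>{0..1}. \<gamma>' t = U' (k' t)"
    by (simp_all add: path_index_def)
  have k_le: "k t \<le> n" if "t \<in> {0..1}" for t
    using k(2) that by auto
  have k'_le: "k' t \<le> n'" if "t \<in> {0..1}" for t
    using k'(2) that by auto
  \<comment> \<open>A monotone map onto \<open>{..n}\<close> attains its extreme values at the ends
    of the unit interval; likewise for \<open>k'\<close> below.\<close>
  have k1: "k 1 = n"
  proof -
    obtain t where "t \<in> {0..1}" "k t = n"
      using k(2) by (metis atMost_iff imageE order_refl)
    then show ?thesis
      using mono_onD[OF k(1), of t 1] k_le[of 1] by simp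
  qed
  have k'0: "k' 0 = 0"
  proof -
    obtain t where "t \<in> {0..1}" "k' t = 0"
      using k'(2) by (metis atMost_iff imageE zero_le)
    then show ?thesis
      using mono_onD[OF k'(1), of 0 t] by simp
  qed
  have Un: "U n = U' 0"
    using eq \<gamma>_eq \<gamma>'_eq k1 k'0 by simp
  \<comment> \<open>The second half is shifted by \<open>n\<close>, not by \<open>n + 1\<close>. At
    1/2 the concatenation still reads \<open>\<gamma>\<close>, so if the first interval of
    \<open>\<gamma>'\<close> is the single point 0, it is never visited; a separate index for it
    would not be attained.\<close>
  define K where "K = (\<lambda>t. if t \<le> 1/2 then k (2 * t) else n + k' (2 * t - 1))"
  define W where "W = (\<lambda>i. if i \<le> n then U i else U' (i - n))"
  have W_add: "W (n + i) = U' i" for i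
    using Un by (simp add: W_def)
  have "mono_on {0..1} K"
  proof (rule mono_onI)
    fix t t' :: real assume t: "t \<in> {0..1}" "t' \<in> {0..1}" "t \<le> t'"
    consider "t' \<le> 1/2" | "t \<le> 1/2" "t' > 1/2" | "t > 1/2"
      by linarith
    then show "K t \<le> K t'"
    proof cases
      case 1
      then show ?thesis
        using t by (auto simp: K_def intro!: mono_onD[OF k(1)])
    next
      case 2
      then show ?thesis
        using t k_le[of "2 * t"] by (auto simp: K_def)
    next
      case 3
      then show ?thesis
        using t by (auto simp: K_def intro!: mono_onD[OF k'(1)])
    qed
  qed
  moreover have "K ` {0..1} = {..n + n'}"
  proof
    show "K ` {0..1} \<subseteq> {..n + n'}"
    proof safe
      fix t :: real assume "t \<in> {0..1}"
      then show "K t \<le> n + n'"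
        using k_le[of "2 * t"] k'_le[of "2 * t - 1"] by (auto simp: K_def)
    qed
    show "{..n + n'} \<subseteq> K ` {0..1}"
    proof
      fix i assume i: "i \<in> {..n + n'}"
      show "i \<in> K ` {0..1}"
      proof (cases "i \<le> n")
        case True
        then obtain t where "t \<in> {0..1}" "k t = i"
          using k(2) by (metis atMost_iff imageE)
        then show ?thesis
          by (intro image_eqI[of _ _ "t / 2"]) (auto simp: K_def)
      next
        case False
        then have "i - n \<in> k' ` {0..1}"
          using i k'(2) by auto
        then obtain t where t: "t \<in> {0..1}" "k' t = i - n"
          by auto
        \<comment> \<open>The second half only reads \<open>\<gamma>'\<close> at positive
          parameters. This suffices, because the index sought is positive and \<open>k'\<close>
          vanishes at 0.\<close>
        with False k'0 have "t \<noteq> 0"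
          by auto
        with t have "(t + 1) / 2 \<in> {0..1}" "\<not> (t + 1) / 2 \<le> 1 / 2" "2 * ((t + 1) / 2) - 1 = t"
          by (auto simp: field_simps)
        moreover from this have "K ((t + 1) / 2) = n + k' t"
          unfolding K_def by (simp only: if_False)
        ultimately show ?thesis
          using t(2) False by (intro image_eqI[of _ _ "(t + 1) / 2"]) simp_all
      qed
    qed
  qed
  moreover have "mono_on {..n + n'} W"
  proof (rule mono_onI)
    fix i j assume ij: "i \<in> {..n + n'}" "j \<in> {..n + n'}" "i \<le> j"
    consider "j \<le> n" | "i \<le> n" "j > n" | "i > n"
      by linarith
    then show "W i \<le> W j"
    proof cases
      case 1
      then show ?thesis
        using ij by (auto simp: W_def intro!: mono_onD[OF U(1)])
    next
      case 2
      then have "U i \<le> U n" "U' 0 \<le> U' (j - n)"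
        using ij by (auto intro!: mono_onD[OF U(1)] mono_onD[OF U'(1)])
      then show ?thesis
        using 2 Un by (auto simp: W_def)
    next
      case 3
      then show ?thesis
        using ij by (auto simp: W_def intro!: mono_onD[OF U'(1)])
    qed
  qed
  moreover have "W ` {..n + n'} \<subseteq> C"
    using U(2) U'(2) by (auto simp: W_def)
  moreover have "\<forall>t\<in>{0..1}. concat_path \<gamma> \<gamma>' t = W (K t)"
  proof
    fix t :: real assume "t \<in> {0..1}"
    then show "concat_path \<gamma> \<gamma>' t = W (K t)"
      using \<gamma>_eq \<gamma>'_eq k_le[of "2 * t"] W_add
      by (auto simp: concat_path_def K_def) (auto simp: W_def)
  qed
  moreover have "concat_path \<gamma> \<gamma>' \<in> extensional {0..1}" "n + n' \<ge> 1"
    using n by (auto simp: concat_path_def)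
  ultimately have "path_index C (concat_path \<gamma> \<gamma>') (n + n') K W" "concat_path \<gamma> \<gamma>' \<in> extensional {0..1}"
    by (simp_all add: path_index_def)
  then show ?thesis
    unfolding paths_iff_index by blast
qed

text \<open>The equivalence class of any path from \<open>U\<close> to \<open>V\<close>, hence the
  only possible morphism \<open>U \<rightarrow> V\<close> of the path category; it is empty unless
  \<open>le_in C U V\<close>.\<close>

definition path_hom :: "'a::order set \<Rightarrow> 'a \<Rightarrow> 'a \<Rightarrow> (real \<Rightarrow> 'a) set" where
  "path_hom C U V = {\<gamma> \<in> paths C. \<gamma> 0 = U \<and> \<gamma> 1 = V}"

definition le_in :: "'a::order set \<Rightarrow> 'a \<Rightarrow> 'a \<Rightarrow> bool" where
  "le_in C U V \<longleftrightarrow> U \<in> C \<and> V \<in> C \<and> U \<le> V"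

lemma path_class_eq: "\<gamma> \<in> paths C \<Longrightarrow> path_class C \<gamma> = path_hom C (\<gamma> 0) (\<gamma> 1)"
  by (auto simp: path_rel_def path_hom_def)

lemma path_le_in: "\<gamma> \<in> paths C \<Longrightarrow> le_in C (\<gamma> 0) (\<gamma> 1)"
  using path_in[of \<gamma> C 0] path_in[of \<gamma> C 1] mono_onD[OF path_mono, of \<gamma> C 0 1]
  by (simp add: le_in_def)

lemma step_path_in_hom: "le_in C U V \<Longrightarrow> step_path U V \<in> path_hom C U V"
  by (simp add: le_in_def path_hom_def step_path_in step_path_ends)

lemma path_hom_nonempty: "path_hom C U V \<noteq> {} \<longleftrightarrow> le_in C U V"
  using step_path_in_hom path_le_in by (fastforce simp: path_hom_def)

lemma Mor_path_cat: "Mor (path_cat C) = {path_hom C U V | U V. le_in C U V}"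
proof -
  have "\<exists>\<gamma>\<in>paths C. path_hom C U V = path_class C \<gamma>" if "le_in C U V" for U V
    using step_path_in_hom[OF that] path_class_eq[of "step_path U V" C]
    by (auto simp: path_hom_def)
  then show ?thesis
    using path_class_eq path_le_in unfolding path_cat_def quotient_def by auto blast
qed

lemma path_cat_Dom_Cod:
  assumes "le_in C U V"
  shows "Dom (path_cat C) (path_hom C U V) = U" "Cod (path_cat C) (path_hom C U V) = V"
proof -
  have "(\<lambda>\<gamma>. \<gamma> 0) ` path_hom C U V = {U}" "(\<lambda>\<gamma>. \<gamma> 1) ` path_hom C U V = {V}"
    using step_path_in_hom[OF assms] by (auto simp: path_hom_def)
  then show "Dom (path_cat C) (path_hom C U V) = U" "Cod (path_cat C) (path_hom C U V) = V"
    by (simp_all add: path_cat_def)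
qed

lemma Hom_path_cat: "Hom (path_cat C) U V = (if le_in C U V then {path_hom C U V} else {})"
  unfolding Hom_def Mor_path_cat by (auto simp: path_cat_Dom_Cod)

lemma path_cat_Id:
  assumes "U \<in> C"
  shows "Id (path_cat C) U = path_hom C U U"
proof -
  have "(\<lambda>t \<in> {0..1}. U) = step_path U U"
    by (auto simp: step_path_def)
  then show ?thesis
    using assms by (simp add: path_cat_def path_class_eq step_path_in step_path_ends)
qed

lemma path_cat_Comp:
  assumes "le_in C U V" "le_in C V W"
  shows "Comp (path_cat C) (path_hom C V W) (path_hom C U V) = path_hom C U W"
proof -
  have "path_class C (concat_path \<gamma> \<gamma>') = path_hom C U W"
    if "\<gamma> \<in> path_hom C U V" "\<gamma>' \<in> path_hom C V W" for \<gamma> \<gamma>'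
    using that by (subst path_class_eq)
      (auto simp: path_hom_def concat_path_in, auto simp: concat_path_def)
  then have "Comp (path_cat C) (path_hom C V W) (path_hom C U V) =
      (\<Union>\<gamma>'\<in>path_hom C V W. \<Union>\<gamma>\<in>path_hom C U V. path_hom C U W)"
    by (simp add: path_cat_def)
  also have "\<dots> = path_hom C U W"
    using assms path_hom_nonempty by auto
  finally show ?thesis .
qed

section \<open>The localization at the pixel morphisms\<close>

text \<open>One representative inside a pixel puts both ends in that pixel. Conversely, if the ends
  share a pixel, the step path stays inside it, as its only values are \<open>U\<close> and
  \<open>V\<close>.\<close>

lemma path_hom_in_pixel_morphisms:
  fixes C :: "'a::lattice set"
  assumes "le_in C U V"
  shows "path_hom C U V \<in> pixel_morphisms C (pixels C Y) \<longleftrightarrow> inf U Y = inf V Y"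
proof
  assume "path_hom C U V \<in> pixel_morphisms C (pixels C Y)"
  then obtain \<rho> X where \<rho>: "path_hom C U V = path_class C \<rho>" "\<rho> \<in> paths C"
    and X: "X \<in> pixels C Y" "\<rho> ` {0..1} \<subseteq> X"
    unfolding pixel_morphisms_def by blast
  have "\<rho> \<in> path_hom C U V"
    using \<rho> by (auto simp: path_rel_def)
  then have "\<rho> 0 = U" "\<rho> 1 = V"
    by (auto simp: path_hom_def)
  moreover have "\<rho> 0 \<in> X" "\<rho> 1 \<in> X"
    using X(2) by auto
  ultimately show "inf U Y = inf V Y"
    using X(1) by (auto simp: pixels_def pixel_def)
next
  assume eq: "inf U Y = inf V Y"
  have UV: "U \<in> C" "V \<in> C"
    using assms by (auto simp: le_in_def)
  then have "pixel C Y (inf V Y) \<in> pixels C Y" "step_path U V ` {0..1} \<subseteq> pixel C Y (inf V Y)"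
    using eq by (auto simp: pixels_def pixel_def step_path_def)
  moreover have "step_path U V \<in> paths C" "path_hom C U V = path_class C (step_path U V)"
    using assms by (simp_all add: le_in_def step_path_in path_class_eq step_path_ends)
  ultimately show "path_hom C U V \<in> pixel_morphisms C (pixels C Y)"
    unfolding pixel_morphisms_def by blast
qed

text \<open>Distributivity splits the left side into a join of two meets, the first of which is
  absorbed by the second. It allows tips of roofs to be enlarged without leaving a pixel.\<close>

lemma inf_eq_sup_tip:
  fixes Y :: "'a::distrib_lattice"
  assumes "inf U Y \<le> inf W Y"
  shows "inf (sup U W) Y = inf W Y"
  using assms by (simp add: inf_sup_distrib2 sup_absorb2)

section \<open>Morphisms of the localization as classes of roofs\<close>

context
  fixes C :: "'a::distrib_lattice set" and Y :: 'a
  assumes C: "sublattice C"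
begin

private abbreviation "PC \<equiv> path_cat C"
private abbreviation "\<Sigma> \<equiv> pixel_morphisms C (pixels C Y)"

text \<open>\<open>Z\<close> is the tip of a roof from \<open>X\<close> to \<open>W\<close> whose
  leg from \<open>W\<close> is inverted. Since morphisms of the path category are determined by
  their ends, these three objects determine the roof.\<close>

definition roof_at :: "'a \<Rightarrow> 'a \<Rightarrow> 'a \<Rightarrow> bool" where
  "roof_at X W Z \<longleftrightarrow> le_in C X Z \<and> le_in C W Z \<and> inf W Y = inf Z Y"

text \<open>All roofs from \<open>X\<close> to \<open>W\<close> at once. By
  \<open>roof_class\<close> they form a single equivalence class, which is then the unique morphism
  \<open>X \<rightarrow> W\<close> of the localization.\<close>

definition loc_hom :: "'a \<Rightarrow> 'a \<Rightarrow> ((real \<Rightarrow> 'a) set \<times> (real \<Rightarrow> 'a) set) set" where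
  "loc_hom X W = {(path_hom C X Z, path_hom C W Z) | Z. roof_at X W Z}"

definition pixel_le :: "'a \<Rightarrow> 'a \<Rightarrow> bool" where
  "pixel_le X W \<longleftrightarrow> X \<in> C \<and> W \<in> C \<and> inf X Y \<le> inf W Y"

lemma sup_in: "U \<in> C \<Longrightarrow> V \<in> C \<Longrightarrow> sup U V \<in> C"
  using C by (simp add: sublattice_def)

lemma roof_at_sup: "pixel_le X W \<Longrightarrow> roof_at X W (sup X W)"
  using inf_eq_sup_tip[of X Y W] sup_in by (simp add: pixel_le_def roof_at_def le_in_def)

lemma roof_at_pixel_le: "roof_at X W Z \<Longrightarrow> pixel_le X W"
  unfolding roof_at_def pixel_le_def le_in_def by (metis inf_mono order_refl)

text \<open>Both tips have the same meet with \<open>Y\<close> as \<open>W\<close>, hence so does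
  their join. This larger tip is what identifies the two roofs.\<close>

lemma roof_at_join:
  assumes "roof_at X W Z" "roof_at X W Z'"
  shows "roof_at X W (sup Z Z')"
  using assms sup_in inf_eq_sup_tip[of Z Y Z'] by (auto simp: roof_at_def le_in_def intro: le_supI1)

lemma roofs_eq: "roofs PC \<Sigma> = {(path_hom C X Z, path_hom C W Z) | X W Z. roof_at X W Z}"
  unfolding roofs_def Mor_path_cat roof_at_def
  using path_hom_in_pixel_morphisms[of C _ _ Y] path_cat_Dom_Cod[of C] by auto metis

text \<open>The roof relation fixes the two ends, so the class contains no other roofs. It contains
  all of these, because any two become equal over the join of their tips.\<close>

lemma roof_class:
  assumes XWZ: "roof_at X W Z"
  shows "frac PC \<Sigma> (path_hom C W Z) (path_hom C X Z) = loc_hom X W"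
proof -
  have le: "le_in C X Z" "le_in C W Z"
    using XWZ by (auto simp: roof_at_def)
  show ?thesis
  proof (intro set_eqI iffI)
    fix p assume "p \<in> frac PC \<Sigma> (path_hom C W Z) (path_hom C X Z)"
    then obtain f' s' where p: "p = (f', s')" "(f', s') \<in> roofs PC \<Sigma>"
      and D: "Dom PC (path_hom C X Z) = Dom PC f'" "Dom PC (path_hom C W Z) = Dom PC s'"
      unfolding frac_def roof_rel_def by auto
    from p(2) obtain X' W' Z' where *: "f' = path_hom C X' Z'" "s' = path_hom C W' Z'" "roof_at X' W' Z'"
      unfolding roofs_eq by blast
    then have "X' = X" "W' = W"
      using D le by (simp_all add: path_cat_Dom_Cod roof_at_def)
    then show "p \<in> loc_hom X W"
      using p * by (auto simp: loc_hom_def)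
  next
    fix p assume "p \<in> loc_hom X W"
    then obtain Z' where p: "p = (path_hom C X Z', path_hom C W Z')" "roof_at X W Z'"
      unfolding loc_hom_def by blast
    have le': "le_in C X Z'" "le_in C W Z'"
      using p(2) by (auto simp: roof_at_def)
    let ?T = "sup Z Z'"
    have T: "roof_at X W ?T"
      using roof_at_join[OF XWZ p(2)] .
    have le_T: "le_in C Z ?T" "le_in C Z' ?T"
      using le le' sup_in by (auto simp: le_in_def)
    have "path_hom C Z ?T \<in> Hom PC Z ?T" "path_hom C Z' ?T \<in> Hom PC Z' ?T"
      using le_T by (simp_all add: Hom_path_cat)
    moreover have "path_hom C W ?T \<in> \<Sigma>"
      using T path_hom_in_pixel_morphisms[of C W ?T Y] by (simp add: roof_at_def)
    moreover have "(path_hom C X Z, path_hom C W Z) \<in> roofs PC \<Sigma>"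
      "(path_hom C X Z', path_hom C W Z') \<in> roofs PC \<Sigma>"
      using XWZ p(2) unfolding roofs_eq by blast+
    ultimately have "((path_hom C X Z, path_hom C W Z), p) \<in> roof_rel PC \<Sigma>"
      unfolding roof_rel_def p(1) using le le' le_T
      by (auto simp: path_cat_Dom_Cod path_cat_Comp intro!: exI[of _ ?T] bexI)
    then show "p \<in> frac PC \<Sigma> (path_hom C W Z) (path_hom C X Z)"
      by (simp add: frac_def)
  qed
qed

lemma loc_hom_nonempty: "loc_hom X W \<noteq> {} \<longleftrightarrow> pixel_le X W"
  using roof_at_sup roof_at_pixel_le by (fastforce simp: loc_hom_def)

lemma Mor_pixelation: "Mor (pixelation C (pixels C Y)) = {loc_hom X W | X W. pixel_le X W}"
proof -
  have "Mor (pixelation C (pixels C Y)) = (\<Union>p\<in>roofs PC \<Sigma>. {roof_rel PC \<Sigma> `` {p}})"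
    by (simp add: pixelation_def localization_def quotient_def)
  also have "\<dots> = {frac PC \<Sigma> (path_hom C W Z) (path_hom C X Z) | X W Z. roof_at X W Z}"
    unfolding roofs_eq frac_def by blast
  also have "\<dots> = {loc_hom X W | X W. pixel_le X W}"
    using roof_class roof_at_sup roof_at_pixel_le by (auto, blast, metis)
  finally show ?thesis .
qed

lemma pixelation_Dom_Cod:
  assumes "pixel_le X W"
  shows "Dom (pixelation C (pixels C Y)) (loc_hom X W) = X"
    "Cod (pixelation C (pixels C Y)) (loc_hom X W) = W"
proof -
  have "Dom PC f = X \<and> Dom PC s = W" if "(f, s) \<in> loc_hom X W" for f s
    using that by (auto simp: loc_hom_def roof_at_def path_cat_Dom_Cod)
  moreover obtain f s where "(f, s) \<in> loc_hom X W"
    using assms loc_hom_nonempty by fastforce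
  ultimately have "(\<lambda>(f, s). Dom PC f) ` loc_hom X W = {X}" "(\<lambda>(f, s). Dom PC s) ` loc_hom X W = {W}"
    by (intro equalityI subsetI; auto intro: rev_image_eqI)+
  then show "Dom (pixelation C (pixels C Y)) (loc_hom X W) = X"
    "Cod (pixelation C (pixels C Y)) (loc_hom X W) = W"
    by (simp_all add: pixelation_def localization_def)
qed

lemma Hom_pixelation:
  "Hom (pixelation C (pixels C Y)) X W = (if pixel_le X W then {loc_hom X W} else {})"
  unfolding Hom_def Mor_pixelation by (auto simp: pixelation_Dom_Cod)

text \<open>The composite is a union over all representatives and all Ore squares. Every choice
  yields a roof from \<open>X\<close> to \<open>V\<close>, hence the same class, and at least one
  choice exists.\<close>

lemma pixelation_Comp:
  assumes XW: "pixel_le X W" and WV: "pixel_le W V"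
  shows "Comp (pixelation C (pixels C Y)) (loc_hom W V) (loc_hom X W) = loc_hom X V"
proof -
  let ?M = "{frac PC \<Sigma> (Comp PC s' t) (Comp PC h f) | f s g t h s' T.
      (f, s) \<in> loc_hom X W \<and> (g, t) \<in> loc_hom W V \<and> h \<in> Hom PC (Cod PC s) T \<and>
      s' \<in> Hom PC (Cod PC g) T \<and> s' \<in> \<Sigma> \<and> Comp PC h s = Comp PC s' g}"
  have "M = loc_hom X V" if "M \<in> ?M" for M
  proof -
    obtain f s g t h s' T where M: "M = frac PC \<Sigma> (Comp PC s' t) (Comp PC h f)"
      and fs: "(f, s) \<in> loc_hom X W" and gt: "(g, t) \<in> loc_hom W V"
      and h: "h \<in> Hom PC (Cod PC s) T" and s': "s' \<in> Hom PC (Cod PC g) T" "s' \<in> \<Sigma>"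
      using \<open>M \<in> ?M\<close> by blast
    obtain Z where Z: "f = path_hom C X Z" "s = path_hom C W Z" "le_in C X Z" "le_in C W Z"
      using fs by (auto simp: loc_hom_def roof_at_def)
    obtain Z' where Z': "g = path_hom C W Z'" "t = path_hom C V Z'" "le_in C W Z'" "le_in C V Z'"
      "inf V Y = inf Z' Y"
      using gt by (auto simp: loc_hom_def roof_at_def)
    have h': "h = path_hom C Z T" "le_in C Z T"
      using h Z by (auto simp: path_cat_Dom_Cod Hom_path_cat split: if_splits)
    have s'': "s' = path_hom C Z' T" "le_in C Z' T"
      using s' Z' by (auto simp: path_cat_Dom_Cod Hom_path_cat split: if_splits)
    have "inf Z' Y = inf T Y"
      using s'(2) s'' path_hom_in_pixel_morphisms by blast
    then have "roof_at X V T"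
      using Z Z' h' s'' by (auto simp: roof_at_def le_in_def)
    then show ?thesis
      using M Z Z' h' s'' roof_class by (simp add: path_cat_Comp)
  qed
  moreover have "?M \<noteq> {}"
  proof -
    obtain Z where Z: "roof_at X W Z" "le_in C X Z" "le_in C W Z" "inf W Y = inf Z Y"
      using roof_at_sup[OF XW] by (auto simp: roof_at_def)
    obtain Z' where Z': "roof_at W V Z'" "le_in C W Z'" "le_in C V Z'"
      using roof_at_sup[OF WV] by (auto simp: roof_at_def)
    \<comment> \<open>The Ore square is completed at the join. Its side from \<open>Z'\<close> stays
      in a pixel, since the meet of \<open>Z\<close> with \<open>Y\<close> equals that of
      \<open>W\<close>, which lies below that of \<open>Z'\<close>.\<close>
    let ?T = "sup Z Z'"
    have le_T: "le_in C Z ?T" "le_in C Z' ?T"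
      using Z Z' sup_in by (auto simp: le_in_def)
    have "inf Z Y \<le> inf Z' Y"
      using Z(4) Z'(2) by (metis inf_mono le_in_def order_refl)
    then have S': "path_hom C Z' ?T \<in> \<Sigma>"
      using path_hom_in_pixel_morphisms[OF le_T(2)] inf_eq_sup_tip[of Z Y Z'] by simp
    have "(path_hom C X Z, path_hom C W Z) \<in> loc_hom X W"
      "(path_hom C W Z', path_hom C V Z') \<in> loc_hom W V"
      using Z(1) Z'(1) unfolding loc_hom_def by blast+
    moreover have "path_hom C Z ?T \<in> Hom PC (Cod PC (path_hom C W Z)) ?T"
      "path_hom C Z' ?T \<in> Hom PC (Cod PC (path_hom C W Z')) ?T"
      "Comp PC (path_hom C Z ?T) (path_hom C W Z) = Comp PC (path_hom C Z' ?T) (path_hom C W Z')"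
      using Z Z' le_T by (simp_all add: path_cat_Dom_Cod Hom_path_cat path_cat_Comp)
    ultimately have "frac PC \<Sigma> (Comp PC (path_hom C Z' ?T) (path_hom C V Z'))
        (Comp PC (path_hom C Z ?T) (path_hom C X Z)) \<in> ?M"
      using S' by blast
    then show ?thesis
      by blast
  qed
  ultimately have "\<Union>?M = loc_hom X V"
    by blast
  then show ?thesis
    by (simp add: pixelation_def localization_def)
qed

lemma pixelation_thin: "thin (pixelation C (pixels C Y))"
  by (auto simp: thin_def Hom_pixelation)

lemma pixelation_Ob: "Ob (pixelation C (pixels C Y)) = C"
  by (simp add: pixelation_def localization_def path_cat_def)

lemma pixelation_category: "category (pixelation C (pixels C Y))"
proof (rule thin_category[OF pixelation_thin])
  fix X assume "X \<in> Ob (pixelation C (pixels C Y))"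
  then have X: "X \<in> C"
    by (simp add: pixelation_Ob)
  have "Id (pixelation C (pixels C Y)) X = frac PC \<Sigma> (path_hom C X X) (path_hom C X X)"
    using X by (simp add: pixelation_def localization_def path_cat_Id)
  also have "\<dots> = loc_hom X X"
    using X by (intro roof_class) (simp add: roof_at_def le_in_def)
  finally show "Id (pixelation C (pixels C Y)) X \<in> Hom (pixelation C (pixels C Y)) X X"
    using X by (simp add: Hom_pixelation pixel_le_def)
next
  fix X W V c d
  assume "c \<in> Hom (pixelation C (pixels C Y)) X W" "d \<in> Hom (pixelation C (pixels C Y)) W V"
  then have "c = loc_hom X W" "d = loc_hom W V" "pixel_le X W" "pixel_le W V"
    by (auto simp: Hom_pixelation split: if_splits)
  moreover from this have "pixel_le X V"
    unfolding pixel_le_def by (blast intro: order_trans)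
  ultimately show "Comp (pixelation C (pixels C Y)) d c \<in> Hom (pixelation C (pixels C Y)) X V"
    by (simp add: Hom_pixelation pixelation_Comp)
qed (auto simp: Mor_pixelation pixelation_Dom_Cod pixelation_Ob, auto simp: pixel_le_def)

text \<open>The forward path jumps once, from \<open>U\<close> to \<open>U \<squnion> V\<close>. The
  latter lies in the pixel of \<open>V\<close>, which differs from that of \<open>U\<close> by
  \<open>ne\<close>, and the inverted path from \<open>V\<close> to \<open>U \<squnion> V\<close>
  stays in that pixel.\<close>

lemma loc_hom_pseudo_arrow:
  assumes le: "pixel_le U V" and ne: "inf U Y \<noteq> inf V Y"
  shows "loc_hom U V \<in> pseudo_arrows C (pixels C Y)"
proof -
  let ?T = "sup U V"
  have T: "roof_at U V ?T"
    using roof_at_sup[OF le] .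
  then have le': "le_in C U ?T" "le_in C V ?T" "inf V Y = inf ?T Y"
    by (auto simp: roof_at_def)
  \<comment> \<open>The cut matches the jump of \<open>step_path\<close>, which still has its first
    value at 1/2.\<close>
  define I where "I = (\<lambda>i::nat. if i = 0 then {0..1/2} else {1/2<..1::real})"
  have I: "interval_partition 1 I"
    unfolding interval_partition_def
    by (auto simp: I_def atMost_Suc is_interval_cc is_interval_oc)
  have "U \<in> C" "?T \<in> C"
    using le' by (auto simp: le_in_def)
  then have X: "pixel C Y (inf U Y) \<in> pixels C Y" "pixel C Y (inf ?T Y) \<in> pixels C Y"
    "pixel C Y (inf U Y) \<noteq> pixel C Y (inf ?T Y)"
    "step_path U ?T ` I 0 \<subseteq> pixel C Y (inf U Y)" "step_path U ?T ` I 1 \<subseteq> pixel C Y (inf ?T Y)"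
    using ne le'(3) by (auto simp: pixels_def pixel_def I_def step_path_def)
  have paths: "step_path V ?T \<in> paths C" "step_path U ?T \<in> paths C"
    using le' by (auto simp: le_in_def step_path_in)
  then have cl: "path_class C (step_path V ?T) = path_hom C V ?T"
    "path_class C (step_path U ?T) = path_hom C U ?T"
    by (simp_all add: path_class_eq step_path_ends)
  have S': "path_class C (step_path V ?T) \<in> \<Sigma>"
    using path_hom_in_pixel_morphisms[OF le'(2)] le'(3) cl by simp
  have "loc_hom U V = frac PC \<Sigma> (path_class C (step_path V ?T)) (path_class C (step_path U ?T))"
    using roof_class[OF T] cl by simp
  moreover have "step_path V ?T 1 = step_path U ?T 1"
    by (simp add: step_path_ends)
  ultimately show ?thesis
    unfolding pseudo_arrows_def using paths S' I X by blast
qed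

end

section \<open>The quiver of pixels\<close>

theorem theorem4p12:
  fixes C :: "'a::distrib_lattice set" and Y :: 'a and s :: "'a set \<Rightarrow> 'a"
  assumes "sublattice C"
    and "\<And>X. X \<in> pixels C Y \<Longrightarrow> s X \<in> X"
  shows "\<exists>Fo Fm. cat_isomorphism (pixel_quiver_cat C (pixels C Y) s) (poset_cat (meet_lattice C Y)) Fo Fm \<and>
    (\<forall>Z. Z \<le> Y \<and> pixel C Y Z \<noteq> {} \<longrightarrow> Fo (pixel C Y Z) = Z)"
proof -
  note C = assms(1)
  let ?B = "pixelation C (pixels C Y)"
  let ?Q = "pixel_quiver C (pixels C Y) s"
  let ?\<Psi> = "free_ext ?B s (\<lambda>(X, m, X'). m)"
  \<comment> \<open>The meet with \<open>Y\<close> is constant on a pixel, so this recovers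
    \<open>Z\<close> from \<open>pixel C Y Z\<close> whichever element \<open>s\<close>
    selects.\<close>
  define Fo where "Fo X = inf (s X) Y" for X
  have s_C: "s X \<in> C" if "X \<in> pixels C Y" for X
    using assms(2)[OF that] that by (auto simp: pixels_def pixel_def)
  have Fo_pixel: "Fo (pixel C Y Z) = Z" if "Z \<le> Y" "pixel C Y Z \<noteq> {}" for Z
    using assms(2)[of "pixel C Y Z"] that by (auto simp: pixels_def pixel_def Fo_def)
  have \<Psi>_in: "?\<Psi> f \<in> Hom ?B (s X) (s X')" if "f \<in> Hom (free_cat ?Q) X X'" for f X X'
    by (rule free_ext_in_Hom[OF pixelation_category[OF C] _ _ that])
      (auto simp: pixel_quiver_def pixelation_Ob[OF C] s_C)
  interpret collapse "free_cat ?Q" ?\<Psi>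
  proof (intro collapse.intro collapse_axioms.intro category_free_cat)
    show "?\<Psi> f = ?\<Psi> g" if "f \<in> Hom (free_cat ?Q) X X'" "g \<in> Hom (free_cat ?Q) X X'" for f g X X'
      using thinD[OF pixelation_thin[OF C] \<Psi>_in[OF that(1)] \<Psi>_in[OF that(2)]] .
  qed
  have Q_cat: "pixel_quiver_cat C (pixels C Y) s = quot_cat (free_cat ?Q) ?\<Psi>"
    by (simp add: pixel_quiver_cat_def)
  have Q_Ob: "Ob (quot_cat (free_cat ?Q) ?\<Psi>) = pixels C Y"
    by (simp add: quot_cat_def free_cat_def pixel_quiver_def)
  have bij: "bij_betw Fo (pixels C Y) (meet_lattice C Y)"
  proof (rule bij_betw_byWitness[where f' = "pixel C Y"])
    show "\<forall>X\<in>pixels C Y. pixel C Y (Fo X) = X"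
    proof
      fix X assume "X \<in> pixels C Y"
      then obtain Z where "X = pixel C Y Z" "Z \<le> Y" "pixel C Y Z \<noteq> {}"
        unfolding pixels_def by blast
      then show "pixel C Y (Fo X) = X"
        using Fo_pixel by simp
    qed
    have "Z \<le> Y \<and> pixel C Y Z \<noteq> {}" if "Z \<in> meet_lattice C Y" for Z
      using that by (auto simp: meet_lattice_def pixel_def)
    then show "\<forall>Z\<in>meet_lattice C Y. Fo (pixel C Y Z) = Z"
      "pixel C Y ` meet_lattice C Y \<subseteq> pixels C Y"
      using Fo_pixel by (auto simp: pixels_def)
    show "Fo ` pixels C Y \<subseteq> meet_lattice C Y"
      using s_C by (auto simp: Fo_def meet_lattice_def)
  qed
  moreover have "Hom (quot_cat (free_cat ?Q) ?\<Psi>) X X' \<noteq> {} \<longleftrightarrow> Fo X \<le> Fo X'"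
    if X: "X \<in> pixels C Y" "X' \<in> pixels C Y" for X X'
  proof
    \<comment> \<open>A walk has an image in the localization from \<open>s X\<close> to
      \<open>s X'\<close>, and such a morphism forces the inequality of meets.\<close>
    assume "Hom (quot_cat (free_cat ?Q) ?\<Psi>) X X' \<noteq> {}"
    then obtain f where "f \<in> Hom (free_cat ?Q) X X'"
      by (auto simp: Hom_quot split: if_splits)
    from \<Psi>_in[OF this] show "Fo X \<le> Fo X'"
      by (auto simp: Hom_pixelation[OF C] pixel_le_def[OF C] Fo_def split: if_splits)
  next
    assume le: "Fo X \<le> Fo X'"
    \<comment> \<open>A walk of length at most one suffices. Pseudo arrows cross between distinct
      pixels, so equal ends are joined by the empty walk.\<close>
    have "\<exists>as. quiver_walk ?Q X as X'"
    proof (cases "X = X'")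
      case True
      then have "quiver_walk ?Q X [] X'"
        using X by (simp add: pixel_quiver_def)
      then show ?thesis ..
    next
      case False
      \<comment> \<open>Injectivity of \<open>Fo\<close> turns distinct pixels into distinct meets,
        as \<open>loc_hom_pseudo_arrow\<close> requires.\<close>
      then have "Fo X \<noteq> Fo X'"
        using bij X by (auto simp: bij_betw_def inj_on_def)
      moreover have "pixel_le C Y (s X) (s X')"
        using le s_C X by (simp only: pixel_le_def[OF C] Fo_def simp_thms)
      ultimately have "loc_hom C Y (s X) (s X') \<in> pseudo_arrows C (pixels C Y)"
        "loc_hom C Y (s X) (s X') \<in> Hom ?B (s X) (s X')"
        using loc_hom_pseudo_arrow[OF C] Hom_pixelation[OF C] by (simp_all add: Fo_def)
      then have "quiver_walk ?Q X [(X, loc_hom C Y (s X) (s X'), X')] X'"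
        using X by (simp add: pixel_quiver_def)
      then show ?thesis ..
    qed
    then show "Hom (quot_cat (free_cat ?Q) ?\<Psi>) X X' \<noteq> {}"
      by (auto simp: Hom_quot Hom_free_cat)
  qed
  ultimately have "cat_isomorphism (pixel_quiver_cat C (pixels C Y) s) (poset_cat (meet_lattice C Y)) Fo
      (\<lambda>f. (Fo (Dom (pixel_quiver_cat C (pixels C Y) s) f),
        Fo (Cod (pixel_quiver_cat C (pixels C Y) s) f)))"
    unfolding Q_cat
    by (intro thin_isomorphic_poset_cat quot_category quot_thin) (simp_all add: Q_Ob)
  then show ?thesis
    using Fo_pixel by blast
qed

end
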